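(* Let $\Omega\subset\mathbb{C}^2$ be a bounded hyperconvex domain containing $0$. Let $E\subset\mathbb{C}\setminus\{0\}$ with $0\in\overline{E}$, and for each $\varepsilon\in E$ let $S_\varepsilon=\{a_1^\varepsilon,a_2^\varepsilon,a_3^\varepsilon\}\subset\Omega$ be a set of three distinct points, all tending to $0$ as $\varepsilon\to0$. Assume that for each $\varepsilon$ the points are numbered so that $$\|a_1^\varepsilon-a_2^\varepsilon\|\ \ge\ \|a_2^\varepsilon-a_3^\varepsilon\|\ \ge\ \|a_1^\varepsilon-a_3^\varepsilon\|,$$ and that (after a translation) $a_1^\varepsilon=(0,0)$. Let $$\theta=\theta(\varepsilon):=\cos^{-1}\left(\frac{|a_2^\varepsilon\cdot\bar a_3^\varepsilon|}{\|a_2^\varepsilon\|\,\|a_3^\varepsilon\|}\right)\in[0,\pi/2].$$ Then $\lim_{\varepsilon\to0}\mathcal{I}(S_\varepsilon)=\mathfrak{M}_0^2$ if and only if $$\lim_{\varepsilon\to0}\frac{\|a_2^\varepsilon\|}{|\theta(\varepsilon)|}=0,$$ or equivalently, if and only if $$\lim_{\varepsilon\to0}\frac{\|a_2^\varepsilon\|}{\left|\det\left(\frac{a_2^\varepsilon}{\|a_2^\varepsilon\|},\frac{a_3^\varepsilon}{\|a_3^\varepsilon\|}\right)\right|}=0,$$ where the determinant is taken with respect to an orthonormal basis of $\mathbb{C}^2$. (A quotient with zero denominator is read as $+\infty$.)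
   Context: Notation: for $z,w\in\mathbb{C}^2$, $z\cdot\bar w=z_1\bar w_1+z_2\bar w_2$ and $\|z\|^2=z\cdot\bar z$. $\mathcal{O}(\Omega)$ is the space of holomorphic functions on $\Omega$; for $S\subset\Omega$, $\mathcal{I}(S)$ is the ideal of all $f\in\mathcal{O}(\Omega)$ vanishing on $S$. $\mathfrak{M}_0^2$ is the square of the maximal ideal at $0$, i.e. the set of $f\in\mathcal{O}(\Omega)$ vanishing at $0$ together with all their first derivatives. Convergence of ideals: let $(\mathcal{I}_\varepsilon)_{\varepsilon\in E}$ be ideals of $\mathcal{O}(\Omega)$. Convergence of holomorphic functions means uniform convergence on compact subsets. $\liminf_{E\ni\varepsilon\to0}\mathcal{I}_\varepsilon$ is the set of $f\in\mathcal{O}(\Omega)$ such that for all $\varepsilon\in E$ there is $f_\varepsilon\in\mathcal{I}_\varepsilon$ with $f_\varepsilon\to f$ as $\varepsilon\to0$. $\limsup_{E\ni\varepsilon\to0}\mathcal{I}_\varepsilon$ is the vector space generated by the set of $f\in\mathcal{O}(\Omega)$ for which there exist a sequence $(\varepsilon_j)\subset E$, $\varepsilon_j\to0$, and $f_j\in\mathcal{I}_{\varepsilon_j}$ with $f_j\to f$ as $j\to\infty$. One writes $\lim_{\varepsilon\to0}\mathcal{I}_\varepsilon=\mathcal{I}$ if and only if $\liminf_{E\ni\varepsilon\to0}\mathcal{I}_\varepsilon=\limsup_{E\ni\varepsilon\to0}\mathcal{I}_\varepsilon=\mathcal{I}$. *)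

theory Defs
  imports "HOL-Analysis.Analysis" "HOL-Library.Function_Algebras"
begin

definition cdot :: "complex^2 \<Rightarrow> complex^2 \<Rightarrow> complex" where
  "cdot z w = (\<Sum>i\<in>UNIV. z $ i * cnj (w $ i))"

definition orthonormal_basis :: "(2 \<Rightarrow> complex^2) \<Rightarrow> bool" where
  "orthonormal_basis e \<longleftrightarrow> (\<forall>i j. cdot (e i) (e j) = (if i = j then 1 else 0))"

definition det_wrt :: "(2 \<Rightarrow> complex^2) \<Rightarrow> complex^2 \<Rightarrow> complex^2 \<Rightarrow> complex" where
  "det_wrt e u v = det (\<chi> i j. cdot (if j = 1 then u else v) (e i))"

definition angle :: "complex^2 \<Rightarrow> complex^2 \<Rightarrow> real" where
  "angle z w = arccos (norm (cdot z w) / (norm z * norm w))"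

text \<open>Functions on \<Omega> are represented by total functions with arbitrary values outside \<Omega>.
  Every set of functions defined below is closed under changing values outside \<Omega>, so
  equality of such sets is equality of the corresponding sets of functions on \<Omega>.

  Holomorphic means that the real derivative exists and is complex linear at each point;
  this is used for open \<Omega> only.\<close>

definition hol :: "(complex^2) set \<Rightarrow> (complex^2 \<Rightarrow> complex) set" where
  "hol \<Omega> = {f. \<forall>z\<in>\<Omega>. \<exists>c :: complex^2.
     (f has_derivative (\<lambda>h. \<Sum>i\<in>UNIV. c $ i * h $ i)) (at z)}"

definition vanishing_ideal ::
    "(complex^2) set \<Rightarrow> (complex^2) set \<Rightarrow> (complex^2 \<Rightarrow> complex) set" where
  "vanishing_ideal \<Omega> S = {f \<in> hol \<Omega>. \<forall>z\<in>S. f z = 0}"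

definition max_ideal_sq :: "(complex^2) set \<Rightarrow> (complex^2 \<Rightarrow> complex) set" where
  "max_ideal_sq \<Omega> = {f \<in> hol \<Omega>. f 0 = 0 \<and> (f has_derivative (\<lambda>_. 0)) (at 0)}"

definition liminf_ideal :: "(complex^2) set \<Rightarrow> complex set \<Rightarrow>
    (complex \<Rightarrow> (complex^2 \<Rightarrow> complex) set) \<Rightarrow> (complex^2 \<Rightarrow> complex) set" where
  "liminf_ideal \<Omega> E I = {f \<in> hol \<Omega>. \<exists>F. (\<forall>\<epsilon>\<in>E. F \<epsilon> \<in> I \<epsilon>) \<and>
     (\<forall>K. compact K \<and> K \<subseteq> \<Omega> \<longrightarrow> uniform_limit K F f (at 0 within E))}"

text \<open>The span is over the complex numbers, with pointwise operations on functions
  (a plain span would be the real one).\<close>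

definition limsup_ideal :: "(complex^2) set \<Rightarrow> complex set \<Rightarrow>
    (complex \<Rightarrow> (complex^2 \<Rightarrow> complex) set) \<Rightarrow> (complex^2 \<Rightarrow> complex) set" where
  "limsup_ideal \<Omega> E I = module.span (\<lambda>(c::complex) f z. c * f z)
     {f \<in> hol \<Omega>. \<exists>e F. (\<forall>j::nat. e j \<in> E) \<and> e \<longlonglongrightarrow> 0 \<and> (\<forall>j. F j \<in> I (e j)) \<and>
       (\<forall>K. compact K \<and> K \<subseteq> \<Omega> \<longrightarrow> uniform_limit K F f sequentially)}"

definition ideal_lim :: "(complex^2) set \<Rightarrow> complex set \<Rightarrow>
    (complex \<Rightarrow> (complex^2 \<Rightarrow> complex) set) \<Rightarrow> (complex^2 \<Rightarrow> complex) set \<Rightarrow> bool" where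
  "ideal_lim \<Omega> E I J \<longleftrightarrow> liminf_ideal \<Omega> E I = J \<and> limsup_ideal \<Omega> E I = J"

text \<open>Continuous plurisubharmonic functions: the sub-mean value inequality holds on the
  boundary of every closed disc, contained in \<Omega>, of a complex line.\<close>

definition continuous_psh_on :: "(complex^2) set \<Rightarrow> (complex^2 \<Rightarrow> real) \<Rightarrow> bool" where
  "continuous_psh_on \<Omega> u \<longleftrightarrow> continuous_on \<Omega> u \<and>
     (\<forall>a b. (\<forall>\<zeta>. norm \<zeta> \<le> 1 \<longrightarrow> a + \<zeta> *s b \<in> \<Omega>) \<longrightarrow>
        u a \<le> 1 / (2 * pi) * integral {0..2*pi} (\<lambda>t. u (a + cis t *s b)))"

definition hyperconvex :: "(complex^2) set \<Rightarrow> bool" where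
  "hyperconvex \<Omega> \<longleftrightarrow> (\<exists>\<psi>. continuous_psh_on \<Omega> \<psi> \<and> (\<forall>z\<in>\<Omega>. \<psi> z < 0) \<and>
     (\<forall>c<0. compact (closure {z\<in>\<Omega>. \<psi> z < c}) \<and> closure {z\<in>\<Omega>. \<psi> z < c} \<subseteq> \<Omega>))"

text \<open>For extended reals, x / 0 is \<infinity> when x is positive; this is
  the convention for quotients with zero denominator.\<close>

definition ext_quotient :: "real \<Rightarrow> real \<Rightarrow> ereal" where
  "ext_quotient x y = ereal x / ereal y"

end

theory Submission
  imports Defs "HOL-Complex_Analysis.Cauchy_Integral_Formula"
begin

text \<open>Write \<open>a\<close>, \<open>b\<close> for the second and third point, \<open>r = norm a\<close>, and \<open>s\<close> for the sine of the angle
  between the complex lines through \<open>a\<close> and \<open>b\<close>. This \<open>s\<close> is the modulus of the determinant of the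
  normalized vectors in every orthonormal basis, and it is comparable to the angle itself, which
  lies in \<open>[0, \<pi>/2]\<close>. So both quotient conditions say that \<open>r / s\<close> tends to \<open>0\<close>.

  Suppose that it does. A bounded holomorphic function that vanishes at \<open>0\<close>, \<open>a\<close> and \<open>b\<close> agrees with
  its linear part up to a quadratic error, so the linear part is \<open>O(r)\<close> on the unit vectors along
  \<open>a\<close> and \<open>b\<close>, and by Cramer's rule (\<open>Cramer_bound\<close>) the gradient at \<open>0\<close> is \<open>O(r / s)\<close>. Limits of such
  functions therefore have zero gradient (\<open>limit_in_max_ideal_sq\<close>). Conversely, a function vanishing
  to second order at \<open>0\<close> becomes a member of the ideal of the three points after subtraction of a
  linear form whose values at \<open>a\<close> and \<open>b\<close> are \<open>O(r\<^sup>2)\<close> and \<open>O((norm b)\<^sup>2)\<close>; by Cramer's rule again,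
  this form is \<open>O(r / s)\<close> (\<open>max_ideal_sq_subset_liminf\<close>).

  Suppose that it does not. Then \<open>s \<le> K * r\<close> along a sequence of parameters. In orthonormal
  coordinates \<open>(x, y)\<close> with \<open>a = (r, 0)\<close>, the three points lie on a parabola \<open>y = c * x * (x - r)\<close>.
  Since \<open>a\<close> is the longest side of the triangle and \<open>b\<close> the shortest, \<open>c\<close> is bounded in terms of \<open>K\<close>
  (\<open>parabola_through_zeros\<close>). By compactness a subsequence of the equations converges to the
  equation \<open>y - c * x\<^sup>2\<close> of a smooth curve through \<open>0\<close>, in limiting coordinates. This limit belongs to
  the upper limit of the ideals, but its gradient at \<open>0\<close> is not zero
  (\<open>limsup_escapes_max_ideal_sq\<close>).\<close>

section \<open>Linear algebra in complex dimension two\<close>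

definition pairing :: "complex^2 \<Rightarrow> complex^2 \<Rightarrow> complex" where
  "pairing c h = (\<Sum>i\<in>UNIV. c $ i * h $ i)"

definition wedge :: "complex^2 \<Rightarrow> complex^2 \<Rightarrow> complex" where
  "wedge u v = u $ 1 * v $ 2 - u $ 2 * v $ 1"

lemma pairing_expand: "pairing c h = c $ 1 * h $ 1 + c $ 2 * h $ 2"
  by (simp add: pairing_def sum_2)

lemma pairing_scale: "pairing c (x *s w) = x * pairing c w"
  by (simp add: pairing_expand algebra_simps)

lemma cdot_expand: "cdot z w = z $ 1 * cnj (w $ 1) + z $ 2 * cnj (w $ 2)"
  by (simp add: cdot_def sum_2)

lemma cdot_self: "cdot z z = of_real ((norm z)\<^sup>2)"
  by (simp add: cdot_expand norm_vec_def L2_set_def sum_2 complex_norm_square del: of_real_power)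

lemma norm_smult_vec: "norm (x *s (w::complex^2)) = norm x * norm w"
  by (simp add: norm_vec_def L2_set_right_distrib norm_mult)

lemma unit_vector_decomp:
  obtains w where "norm w = 1" "z = of_real (norm z) *s (w::complex^2)"
proof (cases "z = 0")
  case True
  show ?thesis by (rule that[of "axis 1 1"]) (auto simp: True vec_eq_iff norm_axis_1)
next
  case False
  show ?thesis
    by (rule that[of "(1 / norm z) *\<^sub>R z"]) (use False in \<open>simp_all add: vec_eq_iff scaleR_conv_of_real[where 'a = complex]\<close>)
qed

text \<open>The identity behind \<open>cos\<^sup>2 + sin\<^sup>2 = 1\<close> for complex lines: \<open>cdot\<close> carries the cosine and
  \<open>wedge\<close> the sine. With \<open>norm w = 1\<close> it is Pythagoras for the components of \<open>z\<close> along \<open>w\<close> and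
  orthogonal to \<open>w\<close>.\<close>

lemma lagrange_identity:
  "(norm (cdot z w))\<^sup>2 + (norm (wedge z w))\<^sup>2 = (norm z)\<^sup>2 * (norm w)\<^sup>2"
proof -
  have "complex_of_real ((norm (cdot z w))\<^sup>2 + (norm (wedge z w))\<^sup>2) = cdot z z * cdot w w"
    by (simp only: of_real_add complex_norm_square, simp add: cdot_expand wedge_def algebra_simps)
  also have "\<dots> = complex_of_real ((norm z)\<^sup>2 * (norm w)\<^sup>2)"
    by (simp add: cdot_self)
  finally show ?thesis
    using of_real_eq_iff by blast
qed

lemma norm_cdot_le: "norm (cdot z w) \<le> norm z * norm w"
proof (rule power2_le_imp_le)
  show "(norm (cdot z w))\<^sup>2 \<le> (norm z * norm w)\<^sup>2"
    using lagrange_identity[of z w] by (simp add: power_mult_distrib) (smt (verit) zero_le_power2)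
qed simp

text \<open>Changing the orthonormal basis multiplies a determinant by the determinant of the basis,
  which is unimodular by the Lagrange identity.\<close>

lemma norm_det_wrt:
  assumes "orthonormal_basis b"
  shows "norm (det_wrt b u v) = norm (wedge u v)"
proof -
  have b: "cdot (b i) (b j) = (if i = j then 1 else 0)" for i j
    using assms by (simp add: orthonormal_basis_def)
  have n: "norm (b i) ^ 2 = 1" for i
    using b[of i i] cdot_self[of "b i"] by (metis of_real_eq_1_iff)
  have "norm (wedge (b 1) (b 2)) ^ 2 = 1"
    using lagrange_identity[of "b 1" "b 2"] n b[of 1 2] by simp
  hence "norm (wedge (b 1) (b 2)) = 1"
    by (simp add: power2_eq_1_iff) (smt (verit) norm_ge_zero)
  moreover have "det_wrt b u v = cnj (wedge (b 1) (b 2)) * wedge u v"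
    by (simp add: det_wrt_def det_2 cdot_expand wedge_def algebra_simps)
  ultimately show ?thesis by (simp add: norm_mult)
qed

text \<open>The sine of the angle between the complex lines spanned by two vectors.\<close>

definition line_sine :: "complex^2 \<Rightarrow> complex^2 \<Rightarrow> real" where
  "line_sine a b = norm (wedge a b) / (norm a * norm b)"

lemma line_sine_nonneg: "0 \<le> line_sine a b"
  by (simp add: line_sine_def)

lemma norm_wedge_eq: "norm (wedge a b) = line_sine a b * norm a * norm b"
proof (cases "a = 0 \<or> b = 0")
  case True
  thus ?thesis by (auto simp: wedge_def)
next
  case False
  thus ?thesis by (simp add: line_sine_def)
qed

lemma norm_det_wrt_normalized:
  assumes "orthonormal_basis e"
  shows "norm (det_wrt e ((1 / norm a) *\<^sub>R a) ((1 / norm b) *\<^sub>R b)) = line_sine a b"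
proof -
  have "wedge ((1 / norm a) *\<^sub>R a) ((1 / norm b) *\<^sub>R b)
      = of_real (1 / (norm a * norm b)) * wedge a b"
    by (simp add: wedge_def scaleR_conv_of_real[where 'a = complex] algebra_simps)
  thus ?thesis
    by (simp add: norm_det_wrt[OF assms] line_sine_def norm_mult norm_divide)
qed

text \<open>Cramer's rule: a linear form is controlled by its values on two vectors, with a loss of one
  factor of the sine of their angle.\<close>

lemma Cramer_bound:
  assumes "norm (pairing c a) \<le> A * norm a" "norm (pairing c b) \<le> A * norm b"
    and "a \<noteq> 0" "b \<noteq> 0"
  shows "norm (c $ i) * line_sine a b \<le> 2 * A"
proof -
  have prod: "norm (x * v $ k) \<le> norm x * norm v" for x and v :: "complex^2" and k
    by (simp add: norm_mult mult_left_mono Finite_Cartesian_Product.norm_nth_le)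
  have "c $ 1 * wedge a b = pairing c a * b $ 2 - pairing c b * a $ 2"
    by (simp add: pairing_expand wedge_def algebra_simps)
  hence 1: "norm (c $ 1 * wedge a b) \<le> norm (pairing c a) * norm b + norm (pairing c b) * norm a"
    using norm_triangle_ineq4[of "pairing c a * b $ 2" "pairing c b * a $ 2"]
      prod[of "pairing c a" b 2] prod[of "pairing c b" a 2] by (smt (verit))
  have "c $ 2 * wedge a b = pairing c b * a $ 1 - pairing c a * b $ 1"
    by (simp add: pairing_expand wedge_def algebra_simps)
  hence 2: "norm (c $ 2 * wedge a b) \<le> norm (pairing c a) * norm b + norm (pairing c b) * norm a"
    using norm_triangle_ineq4[of "pairing c b * a $ 1" "pairing c a * b $ 1"]
      prod[of "pairing c b" a 1] prod[of "pairing c a" b 1] by (smt (verit))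
  have "norm (c $ i * wedge a b) \<le> norm (pairing c a) * norm b + norm (pairing c b) * norm a"
    using exhaust_2[of i] 1 2 by auto
  also have "\<dots> \<le> A * norm a * norm b + A * norm b * norm a"
    by (intro add_mono mult_right_mono assms) auto
  finally have "(norm (c $ i) * line_sine a b) * (norm a * norm b) \<le> (2 * A) * (norm a * norm b)"
    by (simp add: norm_mult norm_wedge_eq algebra_simps)
  thus ?thesis using assms(3,4) by (simp add: mult_le_cancel_right)
qed

section \<open>Angles and quotients\<close>

lemma cosine_bounds:
  "0 \<le> norm (cdot a b) / (norm a * norm b)" "norm (cdot a b) / (norm a * norm b) \<le> 1"
  using norm_cdot_le[of a b] by (auto intro: divide_le_eq_1_pos[THEN iffD2] simp: divide_le_eq_1 zero_less_mult_iff)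

lemma sin_angle:
  assumes "a \<noteq> 0" "b \<noteq> 0"
  shows "sin (angle a b) = line_sine a b"
proof -
  define x where "x = norm (cdot a b) / (norm a * norm b)"
  have "x\<^sup>2 + (line_sine a b)\<^sup>2 = ((norm (cdot a b))\<^sup>2 + (norm (wedge a b))\<^sup>2) / (norm a * norm b)\<^sup>2"
    by (simp add: x_def line_sine_def power_divide add_divide_distrib)
  also have "\<dots> = 1"
    using assms by (simp add: lagrange_identity power_mult_distrib)
  finally have l: "1 - x\<^sup>2 = (line_sine a b)\<^sup>2" by simp
  have "sin (angle a b) = sqrt (1 - x\<^sup>2)"
    unfolding angle_def x_def by (intro sin_arccos cosine_bounds(2) order_trans[OF _ cosine_bounds(1)]) simp
  also have "\<dots> = line_sine a b"
    by (simp add: l line_sine_nonneg)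
  finally show ?thesis .
qed

lemma angle_bounds: "0 \<le> angle a b" "angle a b \<le> pi / 2"
  unfolding angle_def
  by (intro arccos_lbound arccos_le_pi2 cosine_bounds order_trans[OF _ cosine_bounds(1)[of a b]], simp)+

text \<open>The constant comes from \<open>sin x \<ge> x - x ^ 3 / 6\<close> and \<open>x \<le> 2\<close>.\<close>

lemma le_3_sin:
  assumes "0 \<le> x" "x \<le> pi / 2"
  shows "x \<le> 3 * sin (x::real)"
proof -
  have "\<bar>sin x - x\<bar> \<le> inverse (fact 3) * \<bar>x\<bar> ^ 3"
    using Maclaurin_sin_bound[of x 3] by (simp add: sin_coeff_def numeral_3_eq_3)
  moreover have "inverse (fact 3) * \<bar>x\<bar> ^ 3 = x * x\<^sup>2 / 6"
    using assms by (simp add: fact_numeral power3_eq_cube power2_eq_square)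
  moreover have "x\<^sup>2 \<le> 2\<^sup>2"
    using assms pi_less_4 by (intro power_mono) auto
  hence "x * x\<^sup>2 \<le> x * 4"
    using assms by (intro mult_left_mono) auto
  ultimately show ?thesis by linarith
qed

lemma angle_comparable_line_sine:
  assumes "a \<noteq> 0" "b \<noteq> 0"
  shows "line_sine a b \<le> angle a b" "angle a b \<le> 3 * line_sine a b"
  using sin_x_le_x[of "angle a b"] le_3_sin[of "angle a b"] angle_bounds[of a b] sin_angle[OF assms]
  by auto

text \<open>The condition on the right makes the denominator eventually positive, so the value at a
  zero denominator enters only through its not being small. It is multiplicative and hence
  convenient for replacing the denominator by a comparable one.\<close>

lemma ext_quotient_tendsto_0_iff:
  assumes "eventually (\<lambda>x. r x > 0 \<and> y x \<ge> 0) F"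
  shows "((\<lambda>x. ext_quotient (r x) (y x)) \<longlongrightarrow> 0) F \<longleftrightarrow> (\<forall>\<eta>>0. eventually (\<lambda>x. r x < \<eta> * y x) F)"
proof safe
  fix \<eta> :: real assume lim: "((\<lambda>x. ext_quotient (r x) (y x)) \<longlongrightarrow> 0) F" and "\<eta> > 0"
  have "eventually (\<lambda>x. ext_quotient (r x) (y x) < ereal \<eta>) F"
    using order_tendstoD(2)[OF lim, of "ereal \<eta>"] \<open>\<eta> > 0\<close> by simp
  thus "eventually (\<lambda>x. r x < \<eta> * y x) F"
    using assms
  proof eventually_elim
    case (elim x)
    show ?case
    proof (cases "y x = 0")
      case True
      thus ?thesis using elim by (simp add: ext_quotient_def)
    next
      case False
      thus ?thesis using elim by (simp add: ext_quotient_def divide_less_eq mult.commute split: if_splits)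
    qed
  qed
next
  assume small: "\<forall>\<eta>>0. eventually (\<lambda>x. r x < \<eta> * y x) F"
  have pos: "eventually (\<lambda>x. r x > 0 \<and> y x > 0) F"
    using assms small[rule_format, of 1, simplified] by eventually_elim auto
  show "((\<lambda>x. ext_quotient (r x) (y x)) \<longlongrightarrow> 0) F"
  proof (rule order_tendstoI)
    fix a :: ereal assume "a < 0"
    from pos show "eventually (\<lambda>x. a < ext_quotient (r x) (y x)) F"
    proof eventually_elim
      case (elim x)
      hence "0 < ext_quotient (r x) (y x)" by (simp add: ext_quotient_def)
      with \<open>a < 0\<close> show ?case by (rule less_trans)
    qed
  next
    fix a :: ereal assume "0 < a"
    then obtain \<eta> where \<eta>: "0 < ereal \<eta>" "ereal \<eta> < a" using ereal_dense2 by blast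
    hence "eventually (\<lambda>x. r x < \<eta> * y x) F" using small by simp
    with pos show "eventually (\<lambda>x. ext_quotient (r x) (y x) < a) F"
    proof eventually_elim
      case (elim x)
      hence "ext_quotient (r x) (y x) < ereal \<eta>"
        by (simp add: ext_quotient_def divide_less_eq mult.commute)
      thus ?case using \<eta>(2) by (rule less_trans)
    qed
  qed
qed

lemma small_relative_mono:
  fixes r y y' :: "'a \<Rightarrow> real"
  assumes "\<forall>\<eta>>0. eventually (\<lambda>x. r x < \<eta> * y x) F" and "k > 0"
    and "eventually (\<lambda>x. y x \<le> k * y' x) F"
  shows "\<forall>\<eta>>0. eventually (\<lambda>x. r x < \<eta> * y' x) F"
proof safe
  fix \<eta> :: real assume "\<eta> > 0"
  have "eventually (\<lambda>x. r x < \<eta> / k * y x) F"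
    using assms(1)[rule_format, of "\<eta> / k"] assms(2) \<open>\<eta> > 0\<close> by (simp del: times_divide_eq_left)
  with assms(3) show "eventually (\<lambda>x. r x < \<eta> * y' x) F"
  proof eventually_elim
    case (elim x)
    have "\<eta> / k * y x \<le> \<eta> / k * (k * y' x)"
      using elim(1) \<open>\<eta> > 0\<close> \<open>k > 0\<close> by (intro mult_left_mono) auto
    thus ?case using elim(2) \<open>k > 0\<close> by simp
  qed
qed

section \<open>Holomorphic functions of two variables\<close>

lemma hol_derivative:
  assumes "f \<in> hol \<Omega>" "z \<in> \<Omega>"
  obtains c where "(f has_derivative pairing c) (at z)"
  using assms unfolding hol_def pairing_def[abs_def] by blast

lemma holI:
  assumes "\<And>z. z \<in> \<Omega> \<Longrightarrow> \<exists>c. (f has_derivative pairing c) (at z)"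
  shows "f \<in> hol \<Omega>"
  using assms unfolding hol_def pairing_def[abs_def] by blast

lemma hol_continuous_on: "f \<in> hol \<Omega> \<Longrightarrow> continuous_on \<Omega> f"
  by (meson continuous_at_imp_continuous_on has_derivative_continuous hol_derivative)

lemma hol_const: "(\<lambda>_. k) \<in> hol \<Omega>"
  by (rule holI) (auto intro!: exI[of _ 0] simp: pairing_def[abs_def] zero_vec_def)

lemma hol_coord: "(\<lambda>z. z $ i) \<in> hol \<Omega>"
proof (rule holI)
  fix z
  have "(\<lambda>h :: complex^2. h $ i) = pairing (axis i 1)"
    by (auto simp: pairing_def axis_def if_distrib[where f = "\<lambda>x. x * _"] cong: if_cong)
  moreover have "((\<lambda>h :: complex^2. h $ i) has_derivative (\<lambda>h. h $ i)) (at z)"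
    by (rule bounded_linear_imp_has_derivative) (rule bounded_linear_vec_nth)
  ultimately show "\<exists>c. ((\<lambda>z. z $ i) has_derivative pairing c) (at z)"
    by metis
qed

lemma hol_add:
  assumes "f \<in> hol \<Omega>" "g \<in> hol \<Omega>"
  shows "(\<lambda>z. f z + g z) \<in> hol \<Omega>"
proof (rule holI)
  fix z assume z: "z \<in> \<Omega>"
  obtain c where c: "(f has_derivative pairing c) (at z)" using hol_derivative[OF assms(1) z] .
  obtain d where d: "(g has_derivative pairing d) (at z)" using hol_derivative[OF assms(2) z] .
  have "(\<lambda>h. pairing c h + pairing d h) = pairing (c + d)"
    by (auto simp: pairing_expand algebra_simps)
  with has_derivative_add[OF c d] show "\<exists>c. ((\<lambda>z. f z + g z) has_derivative pairing c) (at z)"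
    by metis
qed

lemma hol_mult:
  assumes "f \<in> hol \<Omega>" "g \<in> hol \<Omega>"
  shows "(\<lambda>z. f z * g z) \<in> hol \<Omega>"
proof (rule holI)
  fix z assume z: "z \<in> \<Omega>"
  obtain c where c: "(f has_derivative pairing c) (at z)" using hol_derivative[OF assms(1) z] .
  obtain d where d: "(g has_derivative pairing d) (at z)" using hol_derivative[OF assms(2) z] .
  have "(\<lambda>h. f z * pairing d h + pairing c h * g z) = pairing (f z *s d + g z *s c)"
    by (auto simp: pairing_expand algebra_simps)
  with has_derivative_mult[OF c d] show "\<exists>c. ((\<lambda>z. f z * g z) has_derivative pairing c) (at z)"
    by metis
qed

lemma hol_cmult: "f \<in> hol \<Omega> \<Longrightarrow> (\<lambda>z. k * f z) \<in> hol \<Omega>"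
  by (intro hol_mult hol_const)

lemma hol_diff: "f \<in> hol \<Omega> \<Longrightarrow> g \<in> hol \<Omega> \<Longrightarrow> (\<lambda>z. f z - g z) \<in> hol \<Omega>"
  using hol_add[OF _ hol_cmult[of g \<Omega> "-1"], of f] by simp

lemma hol_pairing: "pairing c \<in> hol \<Omega>"
  unfolding pairing_expand[abs_def] by (intro hol_add hol_cmult hol_coord)

lemma bounded_on_cball:
  assumes "f \<in> hol \<Omega>" "cball 0 \<rho> \<subseteq> \<Omega>"
  obtains M where "M > 0" "\<And>z. norm z \<le> \<rho> \<Longrightarrow> norm (f z) \<le> M"
proof -
  have "compact (f ` cball 0 \<rho>)"
    by (intro compact_continuous_image continuous_on_subset[OF hol_continuous_on[OF assms(1)] assms(2)])
       simp
  then obtain M where "M > 0" "\<forall>y\<in>f ` cball 0 \<rho>. norm y \<le> M"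
    using compact_imp_bounded bounded_pos by metis
  thus ?thesis by (intro that[of M]) auto
qed

text \<open>All approximations below depend continuously on finitely many parameters, so convergence of
  the parameters is all that has to be shown.\<close>

lemma uniform_limit_parameter:
  fixes G :: "'p::topological_space \<Rightarrow> 'z::topological_space \<Rightarrow> 'c::metric_space"
  assumes cont: "continuous_on (UNIV \<times> K) (\<lambda>(x, z). G x z)" and "compact K"
    and lim: "(p \<longlongrightarrow> x0) F"
  shows "uniform_limit K (\<lambda>x. G (p x)) (G x0) F"
proof (rule uniform_limitI)
  fix e :: real assume "e > 0"
  hence "e / 2 > 0" by simp
  obtain X where X: "x0 \<in> X" "open X"
      "\<forall>x\<in>X \<inter> UNIV. \<forall>z\<in>K. dist ((\<lambda>(x, z). G x z) (x, z)) ((\<lambda>(x, z). G x z) (x0, z)) \<le> e / 2"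
    by (rule continuous_on_prod_compactE[OF cont \<open>compact K\<close> UNIV_I[of x0] \<open>e / 2 > 0\<close>])
  have "eventually (\<lambda>x. p x \<in> X) F"
    using lim X(1,2) by (simp add: topological_tendstoD)
  thus "eventually (\<lambda>x. \<forall>z\<in>K. dist (G (p x) z) (G x0 z) < e) F"
  proof eventually_elim
    case (elim x)
    show ?case
    proof
      fix z assume "z \<in> K"
      hence "dist (G (p x) z) (G x0 z) \<le> e / 2" using X(3) elim by auto
      thus "dist (G (p x) z) (G x0 z) < e" using \<open>e > 0\<close> by simp
    qed
  qed
qed

section \<open>Cauchy estimates at the origin\<close>

text \<open>Taylor's formula, with the Cauchy estimate for the second derivative.\<close>

lemma quadratic_remainder_disc:
  fixes g :: "complex \<Rightarrow> complex"
  assumes hol: "g holomorphic_on ball 0 \<rho>" and cont: "continuous_on (cball 0 \<rho>) g"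
    and bd: "\<And>x. norm x \<le> \<rho> \<Longrightarrow> norm (g x) \<le> M"
    and "\<rho> > 0" and \<zeta>: "norm \<zeta> \<le> \<rho> / 2"
  shows "norm (g \<zeta> - g 0 - deriv g 0 * \<zeta>) \<le> 8 * M / \<rho>\<^sup>2 * (norm \<zeta>)\<^sup>2"
proof -
  \<comment> \<open>Discs of radius \<open>\<rho> / 2\<close> about points of the half disc stay in the disc, which bounds the
    second derivative by \<open>2 * M / (\<rho> / 2)\<^sup>2\<close>.\<close>
  have snd: "norm ((deriv ^^ 2) g x) \<le> 8 * M / \<rho>\<^sup>2" if x: "x \<in> cball 0 (\<rho>/2)" for x
  proof -
    have sub: "norm y \<le> \<rho>" if "dist x y \<le> \<rho>/2" for y
      using x that norm_triangle_ineq4[of x "x - y"] by (simp add: dist_norm)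
    have sub': "ball x (\<rho>/2) \<subseteq> ball 0 \<rho>"
    proof
      fix y assume "y \<in> ball x (\<rho>/2)"
      thus "y \<in> ball 0 \<rho>"
        using x norm_triangle_ineq4[of x "x - y"] by (simp add: dist_norm)
    qed
    have "norm ((deriv ^^ 2) g x) \<le> fact 2 * M / (\<rho>/2)^2"
    proof (rule Cauchy_inequality)
      show "g holomorphic_on ball x (\<rho>/2)"
        using hol sub' by (rule holomorphic_on_subset)
      show "continuous_on (cball x (\<rho>/2)) g"
        by (rule continuous_on_subset[OF cont]) (auto simp: sub)
      show "norm (g y) \<le> M" if "norm (x - y) = \<rho>/2" for y
        using that by (intro bd sub) (simp add: dist_norm)
    qed (use \<open>\<rho> > 0\<close> in auto)
    also have "\<dots> = 8 * M / \<rho>\<^sup>2"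
      by (simp add: power2_eq_square)
    finally show ?thesis .
  qed
  have "norm (((deriv ^^ 0) g) \<zeta> - (\<Sum>i\<le>1. ((deriv ^^ i) g) 0 * (\<zeta> - 0) ^ i / fact i))
     \<le> 8 * M / \<rho>\<^sup>2 * norm (\<zeta> - 0) ^ Suc 1 / fact 1"
  proof (rule complex_Taylor[where S = "cball 0 (\<rho>/2)" and f = "\<lambda>i. (deriv ^^ i) g"])
    fix i x assume x: "x \<in> cball (0::complex) (\<rho>/2)"
    have "(deriv ^^ i) g holomorphic_on ball 0 \<rho>"
      by (rule holomorphic_higher_deriv[OF hol]) simp
    hence "((deriv ^^ i) g has_field_derivative deriv ((deriv ^^ i) g) x) (at x)"
      by (rule holomorphic_derivI) (use x \<open>\<rho> > 0\<close> in auto)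
    thus "((deriv ^^ i) g has_field_derivative (deriv ^^ Suc i) g x) (at x within cball 0 (\<rho>/2))"
      by (simp add: has_field_derivative_at_within)
  next
    fix x assume "x \<in> cball (0::complex) (\<rho>/2)"
    thus "norm ((deriv ^^ Suc 1) g x) \<le> 8 * M / \<rho>\<^sup>2"
      using snd[of x] by (simp add: numeral_2_eq_2)
  qed (use \<zeta> \<open>\<rho> > 0\<close> in auto)
  thus ?thesis by (simp add: numeral_2_eq_2 algebra_simps)
qed

text \<open>Restricting to complex lines through the origin reduces the estimates in two variables to
  estimates in one.\<close>

lemma hol_line_restriction:
  assumes f: "f \<in> hol \<Omega>" and w: "norm w = 1" and sub: "cball 0 \<rho> \<subseteq> \<Omega>" 
    and c: "(f has_derivative pairing c) (at 0)" and "\<rho> > 0"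
  defines "g \<equiv> \<lambda>\<zeta>. f (\<zeta> *s w)"
  shows "continuous_on (cball 0 \<rho>) g" "g holomorphic_on ball 0 \<rho>" "deriv g 0 = pairing c w"
proof -
  have nw: "norm (\<zeta> *s w) = norm \<zeta>" for \<zeta> :: complex
    using w by (simp add: norm_smult_vec)
  have lin: "((\<lambda>\<zeta>::complex. \<zeta> *s w) has_derivative (\<lambda>h. h *s w)) (at x)" for x
    by (intro bounded_linear_imp_has_derivative bounded_linear_intro[where K = 1])
       (auto simp: nw vec_eq_iff algebra_simps)
  have D: "(g has_field_derivative pairing d w) (at x)"
    if "(f has_derivative pairing d) (at (x *s w))" for d x
  proof -
    have "(g has_derivative (\<lambda>h. pairing d (h *s w))) (at x)"
      unfolding g_def by (rule has_derivative_compose[OF lin that])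
    moreover have "(\<lambda>h. pairing d (h *s w)) = (*) (pairing d w)"
      by (auto simp: pairing_expand algebra_simps)
    ultimately show ?thesis by (simp add: has_field_derivative_def)
  qed
  have "\<exists>d. (g has_field_derivative d) (at x)" if "norm x \<le> \<rho>" for x
  proof -
    have "x *s w \<in> \<Omega>" using sub that nw by auto
    then obtain d where "(f has_derivative pairing d) (at (x *s w))"
      using f unfolding hol_def pairing_def[abs_def] by blast
    thus ?thesis using D by blast
  qed
  hence *: "g field_differentiable at x" if "norm x \<le> \<rho>" for x
    using that by (auto simp: field_differentiable_def)
  show "continuous_on (cball 0 \<rho>) g"
    by (intro continuous_at_imp_continuous_on ballI field_differentiable_imp_continuous_at *) auto
  show "g holomorphic_on ball 0 \<rho>"
    by (auto simp: holomorphic_on_open intro!: * dest!: field_differentiable_derivI)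
       (use * in \<open>auto simp: field_differentiable_def intro!: less_imp_le\<close>)
  show "deriv g 0 = pairing c w"
    by (rule DERIV_imp_deriv, rule D) (use c in simp)
qed

lemma Cauchy_gradient_bound:
  assumes f: "f \<in> hol \<Omega>" and sub: "cball 0 \<rho> \<subseteq> \<Omega>" 
    and c: "(f has_derivative pairing c) (at 0)" and "\<rho> > 0"
    and bd: "\<And>z. norm z \<le> \<rho> \<Longrightarrow> norm (f z) \<le> M" and h: "norm h = 1"
  shows "norm (pairing c h) \<le> M / \<rho>"
proof -
  note g = hol_line_restriction[OF f h sub c \<open>\<rho> > 0\<close>]
  have "norm ((deriv ^^ 1) (\<lambda>\<zeta>. f (\<zeta> *s h)) 0) \<le> fact 1 * M / \<rho> ^ 1"
  proof (rule Cauchy_inequality[OF g(2,1) \<open>\<rho> > 0\<close>])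
    fix x :: complex assume "norm (0 - x) = \<rho>"
    thus "norm (f (x *s h)) \<le> M"
      by (intro bd) (use h in \<open>auto simp: norm_smult_vec\<close>)
  qed
  thus ?thesis using g(3) by simp
qed

lemma quadratic_remainder:
  assumes f: "f \<in> hol \<Omega>" and sub: "cball 0 \<rho> \<subseteq> \<Omega>" 
    and c: "(f has_derivative pairing c) (at 0)" and "\<rho> > 0"
    and bd: "\<And>z. norm z \<le> \<rho> \<Longrightarrow> norm (f z) \<le> M" and z: "norm z \<le> \<rho> / 2"
  shows "norm (f z - f 0 - pairing c z) \<le> 8 * M / \<rho>\<^sup>2 * (norm z)\<^sup>2"
proof -
  obtain w where w: "norm w = 1" and zw: "z = of_real (norm z) *s (w::complex^2)"
    by (rule unit_vector_decomp)
  note g = hol_line_restriction[OF f w sub c \<open>\<rho> > 0\<close>]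
  have "norm (f (of_real (norm z) *s w) - f (0 *s w) - deriv (\<lambda>\<zeta>. f (\<zeta> *s w)) 0 * of_real (norm z))
     \<le> 8 * M / \<rho>\<^sup>2 * (norm (complex_of_real (norm z)))\<^sup>2"
  proof (rule quadratic_remainder_disc[OF g(2,1)])
    fix x :: complex assume "norm x \<le> \<rho>"
    thus "norm (f (x *s w)) \<le> M"
      by (intro bd) (use w in \<open>auto simp: norm_smult_vec\<close>)
  qed (use z \<open>\<rho> > 0\<close> in auto)
  also have "deriv (\<lambda>\<zeta>. f (\<zeta> *s w)) 0 * of_real (norm z) = pairing c z"
    by (subst (2) zw, subst pairing_scale, subst g(3), simp)
  finally show ?thesis using zw by simp
qed

section \<open>Limits of ideals\<close>

lemma complex_function_module: "module (\<lambda>(c::complex) (f :: 'z \<Rightarrow> complex) z. c * f z)"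
  by unfold_locales (auto simp: fun_eq_iff algebra_simps)

text \<open>The upper limit is a complex span, so an upper bound for it must be a complex subspace.\<close>

lemma max_ideal_sq_subspace:
  "module.subspace (\<lambda>(c::complex) f z. c * f z) (max_ideal_sq \<Omega>)"
proof -
  interpret module "\<lambda>(c::complex) (f :: complex^2 \<Rightarrow> complex) z. c * f z"
    by (rule complex_function_module)
  show ?thesis
  proof (rule subspaceI)
    show "0 \<in> max_ideal_sq \<Omega>"
      using hol_const[of 0 \<Omega>] by (simp add: max_ideal_sq_def zero_fun_def)
  next
    fix f g assume "f \<in> max_ideal_sq \<Omega>" "g \<in> max_ideal_sq \<Omega>"
    thus "f + g \<in> max_ideal_sq \<Omega>"
      using hol_add[of f \<Omega> g] has_derivative_add[of f "\<lambda>_. 0" "at 0" g "\<lambda>_. 0"]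
      by (simp add: max_ideal_sq_def plus_fun_def)
  next
    fix c f assume "f \<in> max_ideal_sq \<Omega>"
    thus "(\<lambda>z. c * f z) \<in> max_ideal_sq \<Omega>"
      using hol_cmult[of f \<Omega> c] has_derivative_mult_right[of f "\<lambda>_. 0" "at 0" c]
      by (simp add: max_ideal_sq_def)
  qed
qed

lemma sequence_frequently:
  fixes E :: "complex set"
  assumes "frequently P (at 0 within E)"
  obtains e where "\<And>j::nat. e j \<in> E" "\<And>j. e j \<noteq> 0" "\<And>j. P (e j)" "e \<longlonglongrightarrow> 0"
proof -
  have "\<exists>x\<in>E. x \<noteq> 0 \<and> P x \<and> norm x < 1 / real (Suc j)" for j
  proof -
    have "eventually (\<lambda>x. x \<in> E \<and> x \<noteq> 0 \<and> norm x < 1 / real (Suc j)) (at 0 within E)"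
      unfolding eventually_at by (rule exI[of _ "1 / real (Suc j)"]) auto
    with assms have "frequently (\<lambda>x. (x \<in> E \<and> x \<noteq> 0 \<and> norm x < 1 / real (Suc j)) \<and> P x) (at 0 within E)"
      by (rule frequently_eventually_conj)
    from frequently_ex[OF this] show ?thesis by blast
  qed
  then obtain e where e: "\<And>j. e j \<in> E \<and> e j \<noteq> 0 \<and> P (e j) \<and> norm (e j) < 1 / real (Suc j)"
    by metis
  have "e \<longlonglongrightarrow> 0"
    by (rule Lim_null_comparison[OF always_eventually LIMSEQ_Suc[OF lim_1_over_n]])
       (use e in \<open>auto intro: less_imp_le\<close>)
  thus ?thesis using that e by blast
qed

lemma limsup_ideal_generator:
  assumes "f \<in> hol \<Omega>" "\<And>j::nat. e j \<in> E" "e \<longlonglongrightarrow> 0" "\<And>j. F j \<in> I (e j)"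
    "\<And>K. compact K \<Longrightarrow> K \<subseteq> \<Omega> \<Longrightarrow> uniform_limit K F f sequentially"
  shows "f \<in> limsup_ideal \<Omega> E I"
proof -
  interpret module "\<lambda>(c::complex) (f :: complex^2 \<Rightarrow> complex) z. c * f z"
    by (rule complex_function_module)
  show ?thesis
    unfolding limsup_ideal_def using assms by (intro span_base) blast
qed

lemma liminf_ideal_subset_limsup_ideal:
  assumes "0 \<notin> E" "0 \<in> closure E"
  shows "liminf_ideal \<Omega> E I \<subseteq> limsup_ideal \<Omega> E I"
proof
  fix f assume f: "f \<in> liminf_ideal \<Omega> E I"
  then obtain F where F: "\<forall>\<epsilon>\<in>E. F \<epsilon> \<in> I \<epsilon>"
      "\<forall>K. compact K \<and> K \<subseteq> \<Omega> \<longrightarrow> uniform_limit K F f (at 0 within E)"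
    by (auto simp: liminf_ideal_def)
  obtain e where e: "\<And>j::nat. e j \<in> E" "e \<longlonglongrightarrow> 0"
    using assms(2) by (auto simp: closure_sequential)
  hence e_lim: "filterlim e (at 0 within E) sequentially"
    using assms(1) by (auto simp: filterlim_at intro!: always_eventually) metis
  show "f \<in> limsup_ideal \<Omega> E I"
  proof (rule limsup_ideal_generator[OF _ e, of f \<Omega> "\<lambda>j. F (e j)"])
    show "f \<in> hol \<Omega>" using f by (simp add: liminf_ideal_def)
    show "F (e j) \<in> I (e j)" for j using F(1) e(1) by blast
    show "uniform_limit K (\<lambda>j. F (e j)) f sequentially" if "compact K" "K \<subseteq> \<Omega>" for K
      using F(2) that by (intro filterlim_compose[OF _ e_lim]) auto
  qed
qed

section \<open>Transversal directions\<close>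

text \<open>By the quadratic remainder, the linear part is of second order at each zero; hence it is at
  most of size \<open>norm a\<close> on the two unit directions, and Cramer's rule gives the whole gradient.\<close>

lemma gradient_bound_of_zeros:
  assumes f: "f \<in> hol \<Omega>" and sub: "cball 0 \<rho> \<subseteq> \<Omega>"
    and c: "(f has_derivative pairing c) (at 0)" and "\<rho> > 0"
    and bd: "\<And>z. norm z \<le> \<rho> \<Longrightarrow> norm (f z) \<le> M"
    and zeros: "f 0 = 0" "f a = 0" "f b = 0"
    and ab: "a \<noteq> 0" "b \<noteq> 0" "norm b \<le> norm a" "norm a \<le> \<rho> / 2"
  shows "norm (c $ i) * line_sine a b \<le> 2 * (8 * M / \<rho>\<^sup>2 * norm a)"
proof (rule Cramer_bound)
  have "M \<ge> 0" using bd[of 0] zeros \<open>\<rho> > 0\<close> by simp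
  hence M: "8 * M / \<rho>\<^sup>2 \<ge> 0" by simp
  note rem = quadratic_remainder[OF f sub c \<open>\<rho> > 0\<close> bd]
  show "norm (pairing c a) \<le> 8 * M / \<rho>\<^sup>2 * norm a * norm a"
    using rem[of a] ab zeros by (simp add: power2_eq_square mult.assoc)
  have "norm (pairing c b) \<le> 8 * M / \<rho>\<^sup>2 * (norm b * norm b)"
    using rem[of b] ab zeros by (simp add: power2_eq_square)
  also have "\<dots> \<le> 8 * M / \<rho>\<^sup>2 * (norm a * norm b)"
    using M ab by (intro mult_left_mono mult_right_mono) auto
  finally show "norm (pairing c b) \<le> 8 * M / \<rho>\<^sup>2 * norm a * norm b"
    by (simp add: mult.assoc)
qed (use ab in auto)

text \<open>Gradients at the origin pass to the limit, and the gradients of the approximating functions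
  are \<open>O(norm a / line_sine a b)\<close>.\<close>

lemma limit_in_max_ideal_sq:
  fixes a b :: "nat \<Rightarrow> complex^2"
  assumes f: "f \<in> hol \<Omega>" and F: "\<And>j. F j \<in> hol \<Omega>"
    and sub: "cball 0 \<rho> \<subseteq> \<Omega>" and "\<rho> > 0"
    and zeros: "\<And>j. F j 0 = 0" "\<And>j. F j (a j) = 0" "\<And>j. F j (b j) = 0"
    and ab: "\<And>j. a j \<noteq> 0" "\<And>j. b j \<noteq> 0" "\<And>j. norm (b j) \<le> norm (a j)"
    and a0: "a \<longlonglongrightarrow> 0"
    and small: "\<And>\<eta>. \<eta> > 0 \<Longrightarrow> eventually (\<lambda>j. norm (a j) < \<eta> * line_sine (a j) (b j)) sequentially"
    and lim: "uniform_limit (cball 0 \<rho>) F f sequentially"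
  shows "f \<in> max_ideal_sq \<Omega>"
proof -
  have "0 \<in> \<Omega>" using sub \<open>\<rho> > 0\<close> by auto
  obtain c where c: "(f has_derivative pairing c) (at 0)"
    using hol_derivative[OF f \<open>0 \<in> \<Omega>\<close>] .
  obtain M where M: "M > 0" "\<And>z. norm z \<le> \<rho> \<Longrightarrow> norm (f z) \<le> M"
    by (rule bounded_on_cball[OF f sub]) blast
  have close: "eventually (\<lambda>j. \<forall>z. norm z \<le> \<rho> \<longrightarrow> norm (F j z - f z) < e) sequentially" if "e > 0" for e
    using uniform_limitD[OF lim that] by (simp add: dist_norm Ball_def)
  have "(\<lambda>j. F j 0) \<longlonglongrightarrow> f 0"
    by (rule tendsto_uniform_limitI[OF lim]) (use \<open>\<rho> > 0\<close> in simp)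
  hence f0: "f 0 = 0"
    by (simp add: zeros(1) LIMSEQ_const_iff)
  have "norm (c $ i) \<le> e + e" if "e > 0" for i e
  proof -
    \<comment> \<open>For large \<open>j\<close> the gradient \<open>d\<close> of \<open>F j\<close> is small because of the three zeros, and
      it is close to \<open>c\<close> by the Cauchy estimate for \<open>F j - f\<close>; each contributes one \<open>e\<close>. The
      constant \<open>K\<close> is the one that the zeros give for functions bounded by \<open>M + 1\<close>.\<close>
    define K where "K = 2 * (8 * (M + 1) / \<rho>\<^sup>2)"
    have "K > 0" using M(1) \<open>\<rho> > 0\<close> by (simp add: K_def)
    have "eventually (\<lambda>j. norm (a j) < \<rho> / 2) sequentially"
      using tendstoD[OF a0, of "\<rho> / 2"] \<open>\<rho> > 0\<close> by simp
    moreover have "eventually (\<lambda>j. \<forall>z. norm z \<le> \<rho> \<longrightarrow> norm (F j z - f z) < min 1 (e * \<rho>)) sequentially"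
      using \<open>e > 0\<close> \<open>\<rho> > 0\<close> by (intro close) simp
    moreover have "eventually (\<lambda>j. norm (a j) < e / K * line_sine (a j) (b j)) sequentially"
      using \<open>e > 0\<close> \<open>K > 0\<close> by (intro small) simp
    ultimately have "eventually (\<lambda>j. norm (c $ i) \<le> e + e) sequentially"
    proof eventually_elim
      case (elim j)
      obtain d where d: "(F j has_derivative pairing d) (at 0)"
        using hol_derivative[OF F \<open>0 \<in> \<Omega>\<close>] .
      have bd: "norm (F j z) \<le> M + 1" if "norm z \<le> \<rho>" for z
        using elim(2) M(2) that norm_triangle_sub[of "F j z" "f z"] by (smt (verit))
      have "norm (d $ i) * line_sine (a j) (b j) \<le> K * norm (a j)"
        using gradient_bound_of_zeros[OF F sub d \<open>\<rho> > 0\<close> bd zeros ab less_imp_le[OF elim(1)], of i]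
        by (simp only: K_def mult.assoc)
      also have "\<dots> \<le> K * (e / K * line_sine (a j) (b j))"
        using elim(3) \<open>K > 0\<close> by (intro mult_left_mono) auto
      finally have "norm (d $ i) * line_sine (a j) (b j) \<le> e * line_sine (a j) (b j)"
        using \<open>K > 0\<close> by simp
      moreover have "line_sine (a j) (b j) > 0"
        using elim(3) line_sine_nonneg[of "a j" "b j"] by (cases "line_sine (a j) (b j) = 0") auto
      ultimately have di: "norm (d $ i) \<le> e" by simp
      have "((\<lambda>z. F j z - f z) has_derivative (\<lambda>h. pairing d h - pairing c h)) (at 0)"
        by (rule has_derivative_diff[OF d c])
      moreover have "(\<lambda>h. pairing d h - pairing c h) = pairing (d - c)"
        by (auto simp: pairing_expand algebra_simps)
      ultimately have dc: "((\<lambda>z. F j z - f z) has_derivative pairing (d - c)) (at 0)" by simp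
      have "norm (pairing (d - c) (axis i 1)) \<le> e * \<rho> / \<rho>"
      proof (rule Cauchy_gradient_bound[OF hol_diff[OF F f] sub dc \<open>\<rho> > 0\<close>])
        show "norm (F j z - f z) \<le> e * \<rho>" if "norm z \<le> \<rho>" for z
          using elim(2) that by (simp add: less_imp_le)
      qed simp
      moreover have "pairing (d - c) (axis i 1) = d $ i - c $ i"
        by (simp add: pairing_def axis_def if_distrib cong: if_cong)
      ultimately have "norm (d $ i - c $ i) \<le> e" using \<open>\<rho> > 0\<close> by simp
      thus ?case using di norm_triangle_sub[of "c $ i" "d $ i"] by (simp add: norm_minus_commute)
    qed
    thus ?thesis by simp
  qed
  hence "norm (c $ i) \<le> e" if "e > 0" for i e
    using that by (metis field_sum_of_halves half_gt_zero)
  hence "c $ i = 0" for i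
    using field_le_epsilon[of "norm (c $ i)" 0] by simp
  hence "pairing c = (\<lambda>_. 0)" by (auto simp: pairing_expand)
  thus ?thesis using f f0 c by (simp add: max_ideal_sq_def)
qed

lemma limsup_subset_max_ideal_sq:
  fixes a b :: "complex \<Rightarrow> complex^2"
  assumes sub: "cball 0 \<rho> \<subseteq> \<Omega>" and "\<rho> > 0" and "0 \<notin> E"
    and ab: "\<And>\<epsilon>. \<epsilon> \<in> E \<Longrightarrow> a \<epsilon> \<noteq> 0 \<and> b \<epsilon> \<noteq> 0 \<and> norm (b \<epsilon>) \<le> norm (a \<epsilon>)"
    and a0: "(a \<longlongrightarrow> 0) (at 0 within E)"
    and small: "\<And>\<eta>. \<eta> > 0 \<Longrightarrow> eventually (\<lambda>\<epsilon>. norm (a \<epsilon>) < \<eta> * line_sine (a \<epsilon>) (b \<epsilon>)) (at 0 within E)"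
  shows "limsup_ideal \<Omega> E (\<lambda>\<epsilon>. vanishing_ideal \<Omega> {0, a \<epsilon>, b \<epsilon>}) \<subseteq> max_ideal_sq \<Omega>"
proof -
  interpret module "\<lambda>(c::complex) (f :: complex^2 \<Rightarrow> complex) z. c * f z"
    by (rule complex_function_module)
  show ?thesis
    unfolding limsup_ideal_def
  proof (rule span_minimal[OF _ max_ideal_sq_subspace], safe)
    fix f e F
    assume f: "f \<in> hol \<Omega>" and e: "\<forall>j::nat. e j \<in> E" "e \<longlonglongrightarrow> 0"
      and F: "\<forall>j. F j \<in> vanishing_ideal \<Omega> {0, a (e j), b (e j)}"
      and lim: "\<forall>K. compact K \<and> K \<subseteq> \<Omega> \<longrightarrow> uniform_limit K F f sequentially"
    have e_lim: "filterlim e (at 0 within E) sequentially"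
      using assms(3) e by (auto simp: filterlim_at intro!: always_eventually) metis
    show "f \<in> max_ideal_sq \<Omega>"
    proof (rule limit_in_max_ideal_sq[OF f _ sub \<open>\<rho> > 0\<close>])
      show "(\<lambda>j. a (e j)) \<longlonglongrightarrow> 0"
        by (rule filterlim_compose[OF a0 e_lim])
      show "eventually (\<lambda>j. norm (a (e j)) < \<eta> * line_sine (a (e j)) (b (e j))) sequentially" if "\<eta> > 0" for \<eta>
        by (rule eventually_compose_filterlim[OF small[OF that] e_lim])
      show "uniform_limit (cball 0 \<rho>) F f sequentially"
        using lim sub by simp
    qed (use F ab e in \<open>auto simp: vanishing_ideal_def\<close>)
  qed
qed

text \<open>The coefficients of the linear form taking the values \<open>s\<close> and \<open>t\<close> at independent vectors \<open>a\<close>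
  and \<open>b\<close>, by Cramer's rule.\<close>

definition interpolant :: "complex^2 \<Rightarrow> complex^2 \<Rightarrow> complex \<Rightarrow> complex \<Rightarrow> complex^2" where
  "interpolant a b s t =
     (\<chi> i. (if i = 1 then s * b $ 2 - t * a $ 2 else t * a $ 1 - s * b $ 1) / wedge a b)"

lemma pairing_interpolant:
  assumes "wedge a b \<noteq> 0"
  shows "pairing (interpolant a b s t) a = s" "pairing (interpolant a b s t) b = t"
proof -
  have "pairing (interpolant a b s t) a * wedge a b = s * wedge a b"
    using assms by (simp add: pairing_expand interpolant_def distrib_right) (simp add: wedge_def algebra_simps)
  thus "pairing (interpolant a b s t) a = s" using assms by simp
  have "pairing (interpolant a b s t) b * wedge a b = t * wedge a b"
    using assms by (simp add: pairing_expand interpolant_def distrib_right) (simp add: wedge_def algebra_simps)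
  thus "pairing (interpolant a b s t) b = t" using assms by simp
qed

lemma tendsto_0_coordwise:
  fixes l :: "'a \<Rightarrow> complex^2"
  assumes "\<And>i e. e > 0 \<Longrightarrow> eventually (\<lambda>x. norm (l x $ i) < e) F"
  shows "(l \<longlongrightarrow> 0) F"
  by (rule vec_tendstoI, rule tendstoI) (simp add: assms)

text \<open>A function in the square of the maximal ideal has values of second order at the points, so
  the linear form which interpolates these values is of size \<open>O(norm a / line_sine a b)\<close>.
  Subtracting it corrects the function by an amount that tends to \<open>0\<close>.\<close>

lemma max_ideal_sq_subset_liminf:
  fixes a b :: "complex \<Rightarrow> complex^2"
  assumes sub: "cball 0 \<rho> \<subseteq> \<Omega>" and "\<rho> > 0"
    and ab: "\<And>\<epsilon>. \<epsilon> \<in> E \<Longrightarrow> a \<epsilon> \<noteq> 0 \<and> b \<epsilon> \<noteq> 0 \<and> norm (b \<epsilon>) \<le> norm (a \<epsilon>)"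
    and a0: "(a \<longlongrightarrow> 0) (at 0 within E)"
    and small: "\<And>\<eta>. \<eta> > 0 \<Longrightarrow> eventually (\<lambda>\<epsilon>. norm (a \<epsilon>) < \<eta> * line_sine (a \<epsilon>) (b \<epsilon>)) (at 0 within E)"
  shows "max_ideal_sq \<Omega> \<subseteq> liminf_ideal \<Omega> E (\<lambda>\<epsilon>. vanishing_ideal \<Omega> {0, a \<epsilon>, b \<epsilon>})"
proof
  fix f assume "f \<in> max_ideal_sq \<Omega>"
  hence f: "f \<in> hol \<Omega>" "f 0 = 0" "(f has_derivative pairing 0) (at 0)"
    by (auto simp: max_ideal_sq_def pairing_def[abs_def])
  obtain M where M: "M > 0" "\<And>z. norm z \<le> \<rho> \<Longrightarrow> norm (f z) \<le> M"
    by (rule bounded_on_cball[OF f(1) sub]) blast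
  define C where "C = 8 * M / \<rho>\<^sup>2"
  have "C > 0" using M(1) \<open>\<rho> > 0\<close> by (simp add: C_def)
  have quad: "norm (f z) \<le> C * (norm z)\<^sup>2" if "norm z \<le> \<rho> / 2" for z
    using quadratic_remainder[OF f(1) sub f(3) \<open>\<rho> > 0\<close> M(2) that] f(2) by (simp add: C_def pairing_def)
  define l where "l \<epsilon> = interpolant (a \<epsilon>) (b \<epsilon>) (f (a \<epsilon>)) (f (b \<epsilon>))" for \<epsilon>
  \<comment> \<open>Where \<open>a \<epsilon>\<close> and \<open>b \<epsilon>\<close> are linearly dependent there is no interpolant. This does not happen
    for small \<open>\<epsilon>\<close>, but membership in the ideal has to hold for every \<open>\<epsilon>\<close>.\<close>
  define F where "F \<epsilon> = (if wedge (a \<epsilon>) (b \<epsilon>) = 0 then (\<lambda>_. 0) else (\<lambda>z. f z - pairing (l \<epsilon>) z))" for \<epsilon>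
  have in_E: "eventually (\<lambda>\<epsilon>. \<epsilon> \<in> E) (at 0 within E)"
    by (simp add: eventually_at_filter)
  have nz: "eventually (\<lambda>\<epsilon>. wedge (a \<epsilon>) (b \<epsilon>) \<noteq> 0) (at 0 within E)"
    using small[of 1, simplified] by eventually_elim (auto simp: line_sine_def)
  have near: "eventually (\<lambda>\<epsilon>. norm (a \<epsilon>) < \<rho> / 2) (at 0 within E)"
    using tendstoD[OF a0, of "\<rho> / 2"] \<open>\<rho> > 0\<close> by simp
  have l0: "(l \<longlongrightarrow> 0) (at 0 within E)"
  proof (rule tendsto_0_coordwise)
    fix i and e :: real assume "e > 0"
    have "eventually (\<lambda>\<epsilon>. norm (a \<epsilon>) < e / (2 * C) * line_sine (a \<epsilon>) (b \<epsilon>)) (at 0 within E)"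
      using \<open>e > 0\<close> \<open>C > 0\<close> by (intro small) simp
    with in_E nz near show "eventually (\<lambda>\<epsilon>. norm (l \<epsilon> $ i) < e) (at 0 within E)"
    proof eventually_elim
      case (elim \<epsilon>)
      have A: "norm (b \<epsilon>) \<le> norm (a \<epsilon>)" "a \<epsilon> \<noteq> 0" "b \<epsilon> \<noteq> 0" using ab[OF elim(1)] by auto
      have "norm (l \<epsilon> $ i) * line_sine (a \<epsilon>) (b \<epsilon>) \<le> 2 * (C * norm (a \<epsilon>))"
      proof (rule Cramer_bound)
        show "norm (pairing (l \<epsilon>) (a \<epsilon>)) \<le> C * norm (a \<epsilon>) * norm (a \<epsilon>)"
          using quad[of "a \<epsilon>"] elim by (simp add: l_def pairing_interpolant power2_eq_square mult.assoc)
        have "norm (pairing (l \<epsilon>) (b \<epsilon>)) \<le> C * (norm (b \<epsilon>) * norm (b \<epsilon>))"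
          using quad[of "b \<epsilon>"] elim A by (simp add: l_def pairing_interpolant power2_eq_square)
        also have "\<dots> \<le> C * (norm (a \<epsilon>) * norm (b \<epsilon>))"
          using \<open>C > 0\<close> A by (intro mult_left_mono mult_right_mono) auto
        finally show "norm (pairing (l \<epsilon>) (b \<epsilon>)) \<le> C * norm (a \<epsilon>) * norm (b \<epsilon>)"
          by (simp add: mult.assoc)
      qed (use A in auto)
      also have "\<dots> < e * line_sine (a \<epsilon>) (b \<epsilon>)"
        using elim(4) \<open>C > 0\<close> by (simp add: field_simps)
      finally show ?case
        using line_sine_nonneg[of "a \<epsilon>" "b \<epsilon>"] by (simp add: mult_less_cancel_right)
    qed
  qed
  have "F \<epsilon> \<in> vanishing_ideal \<Omega> {0, a \<epsilon>, b \<epsilon>}" for \<epsilon>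
    using f(1,2) hol_const[of 0 \<Omega>] hol_diff[OF f(1) hol_pairing]
    by (auto simp: F_def vanishing_ideal_def l_def pairing_interpolant) (auto simp: pairing_def)
  moreover have "uniform_limit K F f (at 0 within E)" if K: "compact K" "K \<subseteq> \<Omega>" for K
  proof -
    have "continuous_on K f"
      using hol_continuous_on[OF f(1)] K(2) by (rule continuous_on_subset)
    hence "continuous_on (UNIV \<times> K) (\<lambda>(c, z). f z - pairing c z)"
      unfolding pairing_expand split_beta
      by (intro continuous_intros continuous_on_compose2[of K f _ snd]) auto
    hence "uniform_limit K (\<lambda>\<epsilon> z. f z - pairing (l \<epsilon>) z) (\<lambda>z. f z - pairing 0 z) (at 0 within E)"
      by (rule uniform_limit_parameter[OF _ K(1) l0])
    moreover have "eventually (\<lambda>\<epsilon>. \<forall>z\<in>K. f z - pairing (l \<epsilon>) z = F \<epsilon> z) (at 0 within E)"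
      using nz by eventually_elim (simp add: F_def)
    ultimately show ?thesis
      by (subst uniform_limit_cong[where g = "\<lambda>\<epsilon> z. f z - pairing (l \<epsilon>) z" and i = "\<lambda>z. f z - pairing 0 z"])
         (auto simp: pairing_def eq_commute)
  qed
  ultimately show "f \<in> liminf_ideal \<Omega> E (\<lambda>\<epsilon>. vanishing_ideal \<Omega> {0, a \<epsilon>, b \<epsilon>})"
    using f(1) by (auto simp: liminf_ideal_def)
qed

section \<open>Nearly aligned points\<close>

text \<open>In the orthonormal coordinates with first axis along \<open>u\<close>, the zero set is the parabola
  \<open>y = c * x * (x - r)\<close>, which contains \<open>0\<close> and \<open>r *\<^sub>R u\<close>.\<close>

definition parabola :: "complex^2 \<Rightarrow> complex \<Rightarrow> real \<Rightarrow> complex^2 \<Rightarrow> complex" where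
  "parabola u c r z = wedge u z - c * (cdot z u * (cdot z u - of_real r))"

lemma parabola_hol: "parabola u c r \<in> hol \<Omega>"
  unfolding parabola_def[abs_def] wedge_def cdot_expand mult.commute[of _ "cnj _"]
  by (intro hol_diff hol_add hol_mult hol_const hol_coord)

text \<open>A parabola is smooth: the linear part at the origin is \<open>wedge u\<close>.\<close>

lemma parabola_not_in_max_ideal_sq:
  assumes "norm u = 1"
  shows "parabola u c 0 \<notin> max_ideal_sq \<Omega>"
proof
  assume "parabola u c 0 \<in> max_ideal_sq \<Omega>"
  hence 1: "(parabola u c 0 has_derivative (\<lambda>_. 0)) (at 0)" by (simp add: max_ideal_sq_def)
  have nth: "((\<lambda>z :: complex^2. z $ i) has_derivative (\<lambda>h. h $ i)) (at 0)" for i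
    by (rule bounded_linear_imp_has_derivative) (rule bounded_linear_vec_nth)
  have 2: "(parabola u c 0 has_derivative wedge u) (at 0)"
    unfolding parabola_def[abs_def] wedge_def[abs_def] cdot_expand
    by (auto intro!: derivative_eq_intros nth)
  \<comment> \<open>The unit vector orthogonal to \<open>u\<close>.\<close>
  define v :: "complex^2" where "v = (\<chi> i. if i = 1 then - cnj (u $ 2) else cnj (u $ 1))"
  have "wedge u v = cdot u u"
    by (simp add: wedge_def v_def cdot_expand)
  moreover have "wedge u v = 0"
    using has_derivative_unique[OF 1 2] by metis
  ultimately show False using assms by (simp add: cdot_self)
qed

text \<open>The coefficient \<open>c\<close> is determined by the third point \<open>b\<close>. Its numerator is at most
  \<open>K * norm a * norm b\<close>. Its denominator is at least a constant times \<open>norm b * norm a\<close>: the side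
  from \<open>b\<close> to \<open>a\<close> has at least half the length of \<open>a\<close>, by the triangle inequality and since the
  side \<open>b\<close> is shorter still, and both sides lie mainly along \<open>u\<close>.\<close>

lemma parabola_through_zeros:
  assumes ab: "a \<noteq> 0" "b \<noteq> 0" "norm (a - b) \<le> norm a" "norm b \<le> norm (a - b)"
    and s: "line_sine a b \<le> K * norm a" "K * norm a \<le> 1 / 4" "K > 0"
  defines "u \<equiv> (1 / norm a) *\<^sub>R a"
  obtains c where "norm c \<le> 8 * K" 
    "parabola u c (norm a) 0 = 0" "parabola u c (norm a) a = 0" "parabola u c (norm a) b = 0"
proof -
  define p where "p = cdot b u"
  define r where "r = norm a"
  have "r > 0" using ab by (simp add: r_def)
  have u: "norm u = 1" using ab by (simp add: u_def)
  have a: "a = of_real r *s u"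
    using ab by (simp add: vec_eq_iff u_def r_def scaleR_conv_of_real[where 'a = complex])
  have au: "cdot a u = of_real r"
  proof -
    have "cdot a u = of_real r * cdot u u" by (subst a) (simp add: cdot_expand algebra_simps)
    thus ?thesis using u by (simp add: cdot_self)
  qed
  have wa: "wedge u a = 0" by (subst a) (simp add: wedge_def)
  \<comment> \<open>In the orthonormal frame given by \<open>u\<close>, the point \<open>b\<close> has coordinates \<open>p\<close> and \<open>wedge u b\<close>. The
    second one is small, so \<open>p\<close> has size comparable to \<open>b\<close>, and \<open>p - r\<close> to \<open>a - b\<close>.\<close>
  have wb: "norm (wedge u b) = line_sine a b * norm b"
  proof -
    have "wedge a b = of_real r * wedge u b" by (subst a) (simp add: wedge_def algebra_simps)
    hence "r * norm (wedge u b) = norm (wedge a b)" using \<open>r > 0\<close> by (simp add: norm_mult)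
    also have "\<dots> = r * (line_sine a b * norm b)" by (simp add: norm_wedge_eq r_def)
    finally show ?thesis using \<open>r > 0\<close> by simp
  qed
  have "line_sine a b \<le> 1 / 4" using s by simp
  hence "norm (wedge u b) \<le> 1 / 4 * norm b" unfolding wb by (rule mult_right_mono) simp
  hence wb2: "(norm (wedge u b))\<^sup>2 \<le> (norm b)\<^sup>2 / 16"
    using power_mono[of "norm (wedge u b)" "1 / 4 * norm b" 2] by (simp add: power_divide)
  have "(norm p)\<^sup>2 + (norm (wedge u b))\<^sup>2 = (norm b)\<^sup>2"
    using lagrange_identity[of b u] u by (simp add: p_def wedge_def norm_minus_commute mult.commute)
  hence "(norm b)\<^sup>2 \<le> 4 * (norm p)\<^sup>2"
    using wb2 zero_le_power2[of "norm b"] by linarith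
  hence "(norm b / 2)\<^sup>2 \<le> (norm p)\<^sup>2"
    by (simp add: power_divide)
  hence p: "norm b / 2 \<le> norm p" by (rule power2_le_imp_le) simp
  have pr_eq: "cdot (b - a) u = p - r"
    using au by (simp add: cdot_expand p_def algebra_simps)
  have "wedge u (b - a) = wedge u b - wedge u a"
    by (simp add: wedge_def algebra_simps)
  hence "norm (wedge (b - a) u) = norm (wedge u b)"
    using wa norm_minus_cancel[of "wedge u (b - a)"] by (simp add: wedge_def algebra_simps)
  hence "(norm (p - r))\<^sup>2 + (norm (wedge u b))\<^sup>2 = (norm (a - b))\<^sup>2"
    using lagrange_identity[of "b - a" u] u by (simp add: pr_eq norm_minus_commute)
  moreover have "r \<le> 2 * norm (a - b)"
    using norm_triangle_sub[of a b] ab by (simp add: r_def)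
  hence "r\<^sup>2 \<le> 4 * (norm (a - b))\<^sup>2"
    using power_mono[of r "2 * norm (a - b)" 2] \<open>r > 0\<close> by (simp add: power_mult_distrib)
  moreover have "(norm b)\<^sup>2 \<le> r\<^sup>2"
    using ab by (intro power_mono) (auto simp: r_def)
  ultimately have "r\<^sup>2 \<le> 16 * (norm (p - r))\<^sup>2"
    using wb2 zero_le_power2[of r] by linarith
  hence "(r / 4)\<^sup>2 \<le> (norm (p - r))\<^sup>2"
    by (simp add: power_divide)
  hence pr: "r / 4 \<le> norm (p - r)" by (rule power2_le_imp_le) simp
  have prod: "norm b / 2 * (r / 4) \<le> norm (p * (p - r))"
    unfolding norm_mult using p pr \<open>r > 0\<close> by (intro mult_mono) auto
  have "0 < norm b / 2 * (r / 4)" using ab \<open>r > 0\<close> by simp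
  hence nz: "0 < norm (p * (p - r))" using prod by linarith
  define c where "c = wedge u b / (p * (p - r))"
  have c: "c * (p * (p - r)) = wedge u b" using nz by (simp add: c_def)
  have "norm (wedge u b) \<le> K * r * norm b"
    unfolding wb using s by (intro mult_right_mono) (auto simp: r_def)
  also have "\<dots> = 8 * K * (norm b / 2 * (r / 4))" by simp
  also have "\<dots> \<le> 8 * K * norm (p * (p - r))" using prod s(3) by (intro mult_left_mono) auto
  finally have "norm c \<le> 8 * K"
    using nz by (simp add: c_def norm_divide divide_le_eq)
  moreover have "parabola u c r 0 = 0" by (simp add: parabola_def wedge_def cdot_def)
  moreover have "parabola u c r a = 0" by (simp add: parabola_def wa au)
  moreover have "parabola u c r b = 0" using c by (simp add: parabola_def p_def)
  ultimately show ?thesis using that by (simp add: r_def)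
qed

text \<open>The parabolas through the three points have directions and coefficients in a compact set, so
  a subsequence converges, and the limit is again the equation of a smooth curve through the
  origin.\<close>

lemma limsup_escapes_max_ideal_sq:
  fixes a b :: "complex \<Rightarrow> complex^2"
  assumes e: "\<And>j::nat. e j \<in> E" "e \<longlonglongrightarrow> 0" and a0: "(\<lambda>j. a (e j)) \<longlonglongrightarrow> 0" and "K > 0"
    and ab: "\<And>\<epsilon>. \<epsilon> \<in> E \<Longrightarrow> a \<epsilon> \<noteq> 0 \<and> b \<epsilon> \<noteq> 0 \<and>
        norm (a \<epsilon> - b \<epsilon>) \<le> norm (a \<epsilon>) \<and> norm (b \<epsilon>) \<le> norm (a \<epsilon> - b \<epsilon>)"
    and s: "\<And>j. line_sine (a (e j)) (b (e j)) \<le> K * norm (a (e j))"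
      "\<And>j. K * norm (a (e j)) \<le> 1 / 4"
  shows "\<not> limsup_ideal \<Omega> E (\<lambda>\<epsilon>. vanishing_ideal \<Omega> {0, a \<epsilon>, b \<epsilon>}) \<subseteq> max_ideal_sq \<Omega>"
proof -
  define r where "r j = norm (a (e j))" for j
  define u where "u j = (1 / r j) *\<^sub>R a (e j)" for j
  have u: "norm (u j) = 1" for j
    using ab[OF e(1)[of j]] by (simp add: u_def r_def)
  have "\<exists>c. norm c \<le> 8 * K \<and> (\<forall>z\<in>{0, a (e j), b (e j)}. parabola (u j) c (r j) z = 0)" for j
    unfolding u_def r_def
    by (rule parabola_through_zeros[of "a (e j)" "b (e j)" K])
       (use ab[OF e(1)[of j]] s[of j] \<open>K > 0\<close> in auto)
  then obtain c where c: "\<And>j. norm (c j) \<le> 8 * K"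
      "\<And>j. \<forall>z\<in>{0, a (e j), b (e j)}. parabola (u j) (c j) (r j) z = 0"
    by metis
  have "seq_compact (cball (0 :: complex^2) 1 \<times> cball (0 :: complex) (8 * K))"
    by (intro compact_imp_seq_compact compact_Times compact_cball)
  moreover have "\<forall>j. (u j, c j) \<in> cball 0 1 \<times> cball 0 (8 * K)"
    using u c(1) by simp
  ultimately obtain l \<phi> where \<phi>: "strict_mono \<phi>" "((\<lambda>j. (u j, c j)) \<circ> \<phi>) \<longlonglongrightarrow> l"
    by (rule seq_compactE)
  obtain u' c' where l: "l = (u', c')" by force
  have lim_u: "(\<lambda>j. u (\<phi> j)) \<longlonglongrightarrow> u'" and lim_c: "(\<lambda>j. c (\<phi> j)) \<longlonglongrightarrow> c'"
    using tendsto_fst[OF \<phi>(2)] tendsto_snd[OF \<phi>(2)] by (simp_all add: l o_def)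
  have "r \<longlonglongrightarrow> 0"
    unfolding r_def using a0 by (rule tendsto_norm_zero)
  hence lim_r: "(\<lambda>j. r (\<phi> j)) \<longlonglongrightarrow> 0"
    using LIMSEQ_subseq_LIMSEQ[OF _ \<phi>(1)] by (fastforce simp: o_def)
  have "(\<lambda>j. norm (u (\<phi> j))) \<longlonglongrightarrow> norm u'"
    using lim_u by (rule tendsto_norm)
  hence "norm u' = 1"
    using LIMSEQ_unique[OF _ tendsto_const] by (simp add: u LIMSEQ_const_iff)
  hence "parabola u' c' 0 \<notin> max_ideal_sq \<Omega>"
    by (rule parabola_not_in_max_ideal_sq)
  moreover have "parabola u' c' 0 \<in> limsup_ideal \<Omega> E (\<lambda>\<epsilon>. vanishing_ideal \<Omega> {0, a \<epsilon>, b \<epsilon>})"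
  proof (rule limsup_ideal_generator[OF parabola_hol])
    show "e (\<phi> j) \<in> E" for j by (rule e(1))
    show "(\<lambda>j. e (\<phi> j)) \<longlonglongrightarrow> 0"
      using LIMSEQ_subseq_LIMSEQ[OF e(2) \<phi>(1)] by (simp add: o_def)
    show "parabola (u (\<phi> j)) (c (\<phi> j)) (r (\<phi> j))
        \<in> vanishing_ideal \<Omega> {0, a (e (\<phi> j)), b (e (\<phi> j))}" for j
      using c(2) parabola_hol by (simp add: vanishing_ideal_def)
    fix L :: "(complex^2) set" assume "compact L"
    define G where "G = (\<lambda>p :: (complex^2) \<times> complex \<times> real. parabola (fst p) (fst (snd p)) (snd (snd p)))"
    have "continuous_on (UNIV \<times> L) (\<lambda>(p, z). G p z)"
      unfolding G_def split_beta parabola_def wedge_def cdot_expand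
      by (intro continuous_intros)
    moreover have "(\<lambda>j. (u (\<phi> j), c (\<phi> j), r (\<phi> j))) \<longlonglongrightarrow> (u', c', 0)"
      by (intro tendsto_Pair lim_u lim_c lim_r)
    ultimately have "uniform_limit L (\<lambda>j. G (u (\<phi> j), c (\<phi> j), r (\<phi> j))) (G (u', c', 0)) sequentially"
      using \<open>compact L\<close> by (intro uniform_limit_parameter)
    thus "uniform_limit L (\<lambda>j. parabola (u (\<phi> j)) (c (\<phi> j)) (r (\<phi> j))) (parabola u' c' 0) sequentially"
      by (simp add: G_def)
  qed
  ultimately show ?thesis by blast
qed

section \<open>The criterion\<close>

lemma ideal_lim_eq_max_ideal_sq_iff:
  fixes a b :: "complex \<Rightarrow> complex^2"
  assumes "open \<Omega>" "0 \<in> \<Omega>" and E: "0 \<notin> E" "0 \<in> closure E"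
    and ab: "\<And>\<epsilon>. \<epsilon> \<in> E \<Longrightarrow> a \<epsilon> \<noteq> 0 \<and> b \<epsilon> \<noteq> 0 \<and>
        norm (a \<epsilon> - b \<epsilon>) \<le> norm (a \<epsilon>) \<and> norm (b \<epsilon>) \<le> norm (a \<epsilon> - b \<epsilon>)"
    and a0: "(a \<longlongrightarrow> 0) (at 0 within E)"
  shows "ideal_lim \<Omega> E (\<lambda>\<epsilon>. vanishing_ideal \<Omega> {0, a \<epsilon>, b \<epsilon>}) (max_ideal_sq \<Omega>) \<longleftrightarrow>
    (\<forall>\<eta>>0. eventually (\<lambda>\<epsilon>. norm (a \<epsilon>) < \<eta> * line_sine (a \<epsilon>) (b \<epsilon>)) (at 0 within E))"
    (is "?lim \<longleftrightarrow> ?small")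
proof
  assume ?small
  hence small: "eventually (\<lambda>\<epsilon>. norm (a \<epsilon>) < \<eta> * line_sine (a \<epsilon>) (b \<epsilon>)) (at 0 within E)"
    if "\<eta> > 0" for \<eta> using that by blast
  obtain \<rho> where \<rho>: "\<rho> > 0" "cball 0 \<rho> \<subseteq> \<Omega>"
    using assms(1,2) open_contains_cball by blast
  have ab': "a \<epsilon> \<noteq> 0 \<and> b \<epsilon> \<noteq> 0 \<and> norm (b \<epsilon>) \<le> norm (a \<epsilon>)" if "\<epsilon> \<in> E" for \<epsilon>
    using ab[OF that] by linarith
  show ?lim
    unfolding ideal_lim_def
    using max_ideal_sq_subset_liminf[OF \<rho>(2,1) ab' a0 small]
      limsup_subset_max_ideal_sq[OF \<rho>(2,1) E(1) ab' a0 small]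
      liminf_ideal_subset_limsup_ideal[OF E]
    by blast
next
  assume lim: ?lim
  show ?small
  proof (rule ccontr)
    assume "\<not> ?small"
    then obtain \<eta> where \<eta>: "\<eta> > 0"
      "frequently (\<lambda>\<epsilon>. \<not> norm (a \<epsilon>) < \<eta> * line_sine (a \<epsilon>) (b \<epsilon>)) (at 0 within E)"
      by (auto simp: not_eventually)
    \<comment> \<open>With \<open>K = 1 / \<eta>\<close>, this is the bound \<open>K * norm (a \<epsilon>) \<le> 1 / 4\<close> which keeps the parabolas
      uniformly bounded.\<close>
    have "eventually (\<lambda>\<epsilon>. norm (a \<epsilon>) < \<eta> / 4) (at 0 within E)"
      using tendstoD[OF a0, of "\<eta> / 4"] \<eta>(1) by simp
    from frequently_eventually_conj[OF \<eta>(2) this]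
    obtain e where e: "\<And>j::nat. e j \<in> E" "e \<longlonglongrightarrow> 0" "\<And>j. e j \<noteq> 0"
      "\<And>j. norm (a (e j)) < \<eta> / 4 \<and> \<not> norm (a (e j)) < \<eta> * line_sine (a (e j)) (b (e j))"
      by (rule sequence_frequently) blast
    have e_lim: "filterlim e (at 0 within E) sequentially"
      using e by (auto simp: filterlim_at intro!: always_eventually)
    have "\<not> limsup_ideal \<Omega> E (\<lambda>\<epsilon>. vanishing_ideal \<Omega> {0, a \<epsilon>, b \<epsilon>}) \<subseteq> max_ideal_sq \<Omega>"
    proof (rule limsup_escapes_max_ideal_sq[OF e(1,2) _ _ ab])
      show "(\<lambda>j. a (e j)) \<longlonglongrightarrow> 0"
        by (rule filterlim_compose[OF a0 e_lim])
      show "1 / \<eta> > 0" using \<eta>(1) by simp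
      show "line_sine (a (e j)) (b (e j)) \<le> 1 / \<eta> * norm (a (e j))"
        "1 / \<eta> * norm (a (e j)) \<le> 1 / 4" for j
        using e(4)[of j] \<eta>(1) by (auto simp: field_simps)
    qed
    thus False using lim by (simp add: ideal_lim_def)
  qed
qed

theorem theorem1p4:
  fixes \<Omega> :: "(complex^2) set" and E :: "complex set"
    and a1 a2 a3 :: "complex \<Rightarrow> complex^2"
    and b :: "2 \<Rightarrow> complex^2"
  assumes "open \<Omega>" and "connected \<Omega>" and "bounded \<Omega>" and "hyperconvex \<Omega>" and "0 \<in> \<Omega>"
    and "0 \<notin> E" and "0 \<in> closure E"
    and "\<And>\<epsilon>. \<epsilon> \<in> E \<Longrightarrow> {a1 \<epsilon>, a2 \<epsilon>, a3 \<epsilon>} \<subseteq> \<Omega>"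
    and "\<And>\<epsilon>. \<epsilon> \<in> E \<Longrightarrow> a1 \<epsilon> \<noteq> a2 \<epsilon> \<and> a2 \<epsilon> \<noteq> a3 \<epsilon> \<and> a1 \<epsilon> \<noteq> a3 \<epsilon>"
    and "(a1 \<longlongrightarrow> 0) (at 0 within E)"
    and "(a2 \<longlongrightarrow> 0) (at 0 within E)"
    and "(a3 \<longlongrightarrow> 0) (at 0 within E)"
    and "\<And>\<epsilon>. \<epsilon> \<in> E \<Longrightarrow> norm (a1 \<epsilon> - a2 \<epsilon>) \<ge> norm (a2 \<epsilon> - a3 \<epsilon>)"
    and "\<And>\<epsilon>. \<epsilon> \<in> E \<Longrightarrow> norm (a2 \<epsilon> - a3 \<epsilon>) \<ge> norm (a1 \<epsilon> - a3 \<epsilon>)"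
    and "\<And>\<epsilon>. \<epsilon> \<in> E \<Longrightarrow> a1 \<epsilon> = 0"
    and "orthonormal_basis b"
  defines "\<theta> \<equiv> \<lambda>\<epsilon>. angle (a2 \<epsilon>) (a3 \<epsilon>)"
  shows "(ideal_lim \<Omega> E (\<lambda>\<epsilon>. vanishing_ideal \<Omega> {a1 \<epsilon>, a2 \<epsilon>, a3 \<epsilon>}) (max_ideal_sq \<Omega>) \<longleftrightarrow>
           ((\<lambda>\<epsilon>. ext_quotient (norm (a2 \<epsilon>)) \<bar>\<theta> \<epsilon>\<bar>) \<longlongrightarrow> 0) (at 0 within E)) \<and>
         (ideal_lim \<Omega> E (\<lambda>\<epsilon>. vanishing_ideal \<Omega> {a1 \<epsilon>, a2 \<epsilon>, a3 \<epsilon>}) (max_ideal_sq \<Omega>) \<longleftrightarrow>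
           ((\<lambda>\<epsilon>. ext_quotient (norm (a2 \<epsilon>))
              (norm (det_wrt b ((1 / norm (a2 \<epsilon>)) *\<^sub>R a2 \<epsilon>) ((1 / norm (a3 \<epsilon>)) *\<^sub>R a3 \<epsilon>))))
              \<longlongrightarrow> 0) (at 0 within E))"
proof -
  let ?small = "\<lambda>y. \<forall>\<eta>>0. eventually (\<lambda>\<epsilon>. norm (a2 \<epsilon>) < \<eta> * y \<epsilon>) (at 0 within E)"
  let ?sine = "\<lambda>\<epsilon>. line_sine (a2 \<epsilon>) (a3 \<epsilon>)"
  have a: "a2 \<epsilon> \<noteq> 0 \<and> a3 \<epsilon> \<noteq> 0 \<and>
      norm (a2 \<epsilon> - a3 \<epsilon>) \<le> norm (a2 \<epsilon>) \<and> norm (a3 \<epsilon>) \<le> norm (a2 \<epsilon> - a3 \<epsilon>)" if "\<epsilon> \<in> E" for \<epsilon>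
    using assms(9,13,14,15)[OF that] by auto
  have ev_a: "eventually (\<lambda>\<epsilon>. a2 \<epsilon> \<noteq> 0 \<and> a3 \<epsilon> \<noteq> 0) (at 0 within E)"
    using a by (auto simp: eventually_at_filter)
  have "ideal_lim \<Omega> E (\<lambda>\<epsilon>. vanishing_ideal \<Omega> {a1 \<epsilon>, a2 \<epsilon>, a3 \<epsilon>}) (max_ideal_sq \<Omega>) \<longleftrightarrow>
      ideal_lim \<Omega> E (\<lambda>\<epsilon>. vanishing_ideal \<Omega> {0, a2 \<epsilon>, a3 \<epsilon>}) (max_ideal_sq \<Omega>)"
  proof -
    \<comment> \<open>The two families agree on \<open>E\<close> only, but neither limit involves ideals at other parameters.\<close>
    define I where "I = (\<lambda>\<epsilon>. vanishing_ideal \<Omega> {a1 \<epsilon>, a2 \<epsilon>, a3 \<epsilon>})"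
    define J where "J = (\<lambda>\<epsilon>. vanishing_ideal \<Omega> {0, a2 \<epsilon>, a3 \<epsilon>})"
    have IJ: "I \<epsilon> = J \<epsilon>" if "\<epsilon> \<in> E" for \<epsilon>
      using assms(15)[OF that] by (simp add: I_def J_def)
    have "(\<forall>j::nat. e j \<in> E) \<and> e \<longlonglongrightarrow> 0 \<and> (\<forall>j. F j \<in> I (e j)) \<and> P \<longleftrightarrow>
        (\<forall>j::nat. e j \<in> E) \<and> e \<longlonglongrightarrow> 0 \<and> (\<forall>j. F j \<in> J (e j)) \<and> P" for e F P
      using IJ by auto
    hence "ideal_lim \<Omega> E I X \<longleftrightarrow> ideal_lim \<Omega> E J X" for X
      by (simp add: ideal_lim_def liminf_ideal_def limsup_ideal_def IJ cong: ball_cong)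
    thus ?thesis by (simp add: I_def J_def)
  qed
  also have "\<dots> \<longleftrightarrow> ?small ?sine"
    by (rule ideal_lim_eq_max_ideal_sq_iff[OF assms(1,5,6,7) a assms(11)])
  finally have main: "ideal_lim \<Omega> E (\<lambda>\<epsilon>. vanishing_ideal \<Omega> {a1 \<epsilon>, a2 \<epsilon>, a3 \<epsilon>}) (max_ideal_sq \<Omega>) \<longleftrightarrow>
      ?small ?sine" .
  have "((\<lambda>\<epsilon>. ext_quotient (norm (a2 \<epsilon>)) \<bar>\<theta> \<epsilon>\<bar>) \<longlongrightarrow> 0) (at 0 within E) \<longleftrightarrow> ?small (\<lambda>\<epsilon>. \<bar>\<theta> \<epsilon>\<bar>)"
    using ev_a by (intro ext_quotient_tendsto_0_iff) (auto elim: eventually_mono)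
  moreover have "?small ?sine \<longleftrightarrow> ?small (\<lambda>\<epsilon>. \<bar>\<theta> \<epsilon>\<bar>)"
  proof
    assume *: "?small ?sine"
    show "?small (\<lambda>\<epsilon>. \<bar>\<theta> \<epsilon>\<bar>)"
      by (rule small_relative_mono[OF *, of 1], simp, rule eventually_mono[OF ev_a])
         (use angle_comparable_line_sine(1) in \<open>force simp: \<theta>_def\<close>)
  next
    assume *: "?small (\<lambda>\<epsilon>. \<bar>\<theta> \<epsilon>\<bar>)"
    show "?small ?sine"
      by (rule small_relative_mono[OF *, of 3], simp, rule eventually_mono[OF ev_a])
         (use angle_comparable_line_sine(2) angle_bounds(1) in \<open>force simp: \<theta>_def\<close>)
  qed
  moreover have "((\<lambda>\<epsilon>. ext_quotient (norm (a2 \<epsilon>))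
      (norm (det_wrt b ((1 / norm (a2 \<epsilon>)) *\<^sub>R a2 \<epsilon>) ((1 / norm (a3 \<epsilon>)) *\<^sub>R a3 \<epsilon>)))) \<longlongrightarrow> 0) (at 0 within E)
      \<longleftrightarrow> ?small ?sine"
    unfolding norm_det_wrt_normalized[OF assms(16)]
    using ev_a by (intro ext_quotient_tendsto_0_iff) (auto elim: eventually_mono simp: line_sine_nonneg)
  ultimately show ?thesis using main by blast
qed

end
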